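(* For every $f \in L^{\infty}([1,\infty))$, $$\sup_{\psi \in \mathcal{C}} \psi(f) = \overline{Q}(f).$$
   Context: $L^{\infty}([1,\infty))$ is the space of real-valued essentially bounded measurable functions on $[1,\infty)$ (Lebesgue measure), and $L^{\infty}([1,\infty))^*$ is its dual. For $f\in L^{\infty}([1,\infty))$ put $M(f)=\lim_{x\to\infty}\frac1x\int_1^x f(t)\,dt$ whenever this limit exists. $E_0$ is the subspace of all $f\in L^\infty([1,\infty))$ for which $M(f)$ exists and equals $0$. $\mathcal{C}$ is the set of positive linear functionals of norm $1$ on $L^{\infty}([1,\infty))$ that vanish on $E_0$ (equivalently, normalized positive linear functionals extending $M$). The sublinear functional $\overline{Q}$ is $$\overline{Q}(f)=\lim_{\theta\to1^+}\limsup_{x\to\infty}\frac{1}{\log\theta}\int_x^{\theta x}f(t)\,\frac{dt}{t}.$$ *)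

theory Defs
  imports "HOL-Probability.Essential_Supremum"
begin

section \<open>The space of essentially bounded functions on the half-line\<close>

abbreviation halfline :: "real measure" where
  "halfline \<equiv> lebesgue_on {1..}"

definition ess_bounded :: "(real \<Rightarrow> real) \<Rightarrow> bool" where
  "ess_bounded f \<longleftrightarrow>
     f \<in> borel_measurable halfline \<and> esssup halfline (\<lambda>t. ereal \<bar>f t\<bar>) < \<infinity>"

definition ae_rel :: "(real \<Rightarrow> real) \<Rightarrow> (real \<Rightarrow> real) \<Rightarrow> bool" where
  "ae_rel f g \<longleftrightarrow> ess_bounded f \<and> ess_bounded g \<and> (AE t in halfline. f t = g t)"

lemma halfline_nontrivial: "emeasure halfline (space halfline) \<noteq> 0"
proof -
  have "emeasure lborel {1..2::real} \<le> emeasure lborel {1::real..}"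
    by (rule emeasure_mono) auto
  then have "emeasure lebesgue {1::real..} \<noteq> 0"
    by auto
  then show ?thesis
    by (simp add: space_restrict_space emeasure_restrict_space)
qed

lemma ess_boundedI:
  assumes "f \<in> borel_measurable halfline" "AE t in halfline. \<bar>f t\<bar> \<le> c"
  shows "ess_bounded f"
proof -
  have "esssup halfline (\<lambda>t. ereal \<bar>f t\<bar>) \<le> ereal c"
    using assms by (intro esssup_I) auto
  then show ?thesis
    using assms(1) by (auto simp: ess_bounded_def intro: le_less_trans)
qed

lemma esssup_abs_nonneg:
  assumes "f \<in> borel_measurable halfline"
  shows "0 \<le> esssup halfline (\<lambda>t. ereal \<bar>f t\<bar>)"
proof -
  have "esssup halfline (\<lambda>t. 0::ereal) \<le> esssup halfline (\<lambda>t. ereal \<bar>f t\<bar>)"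
    by (rule esssup_mono) auto
  then show ?thesis
    by (simp add: esssup_const[OF halfline_nontrivial])
qed

lemma ess_bounded_esssup:
  assumes "ess_bounded f"
  shows "ereal (real_of_ereal (esssup halfline (\<lambda>t. ereal \<bar>f t\<bar>))) =
    esssup halfline (\<lambda>t. ereal \<bar>f t\<bar>)"
  using assms esssup_abs_nonneg[of f]
  by (cases "esssup halfline (\<lambda>t. ereal \<bar>f t\<bar>)") (auto simp: ess_bounded_def)

lemma ess_bounded_AE:
  assumes "ess_bounded f"
  shows "AE t in halfline. \<bar>f t\<bar> \<le> real_of_ereal (esssup halfline (\<lambda>t. ereal \<bar>f t\<bar>))"
proof -
  have "AE t in halfline. ereal \<bar>f t\<bar> \<le> ereal (real_of_ereal (esssup halfline (\<lambda>t. ereal \<bar>f t\<bar>)))"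
    unfolding ess_bounded_esssup[OF assms] by (rule esssup_AE)
  then show ?thesis
    by (simp only: ereal_less_eq)
qed

lemma ess_bounded_zero: "ess_bounded (\<lambda>_. 0)"
  by (rule ess_boundedI[where c = 0]) auto

lemma ess_bounded_add:
  assumes "ess_bounded f" "ess_bounded g"
  shows "ess_bounded (\<lambda>t. f t + g t)"
proof (rule ess_boundedI)
  show "(\<lambda>t. f t + g t) \<in> borel_measurable halfline"
    using assms by (auto simp: ess_bounded_def)
  show "AE t in halfline. \<bar>f t + g t\<bar> \<le>
      real_of_ereal (esssup halfline (\<lambda>t. ereal \<bar>f t\<bar>)) +
      real_of_ereal (esssup halfline (\<lambda>t. ereal \<bar>g t\<bar>))"
    using ess_bounded_AE[OF assms(1)] ess_bounded_AE[OF assms(2)]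
    by eventually_elim linarith
qed

lemma ess_bounded_scale:
  assumes "ess_bounded f"
  shows "ess_bounded (\<lambda>t. c * f t)"
proof (rule ess_boundedI)
  show "(\<lambda>t. c * f t) \<in> borel_measurable halfline"
    using assms by (auto simp: ess_bounded_def)
  show "AE t in halfline. \<bar>c * f t\<bar> \<le>
      \<bar>c\<bar> * real_of_ereal (esssup halfline (\<lambda>t. ereal \<bar>f t\<bar>))"
    using ess_bounded_AE[OF assms] by eventually_elim (simp add: abs_mult mult_left_mono)
qed

text \<open>Real-valued essentially bounded functions modulo equality almost everywhere.
  Representatives are total functions on \<^typ>\<open>real\<close>; their values below \<open>1\<close> are irrelevant.\<close>

quotient_type linf = "real \<Rightarrow> real" / partial: ae_rel
proof (rule part_equivpI)
  show "\<exists>f. ae_rel f f"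
    using ess_bounded_zero by (auto simp: ae_rel_def)
  show "symp ae_rel"
    by (auto simp: ae_rel_def symp_def)
  show "transp ae_rel"
    by (auto simp: ae_rel_def transp_def)
qed

lemma ess_bounded_minus:
  assumes "ess_bounded f" shows "ess_bounded (\<lambda>t. - f t)"
  using ess_bounded_scale[OF assms, of "-1"] by simp

lemma ess_bounded_diff:
  assumes "ess_bounded f" "ess_bounded g" shows "ess_bounded (\<lambda>t. f t - g t)"
  using ess_bounded_add[OF assms(1) ess_bounded_minus[OF assms(2)]] by simp

instantiation linf :: real_vector
begin

lift_definition zero_linf :: linf is "\<lambda>_. 0"
  by (simp add: ae_rel_def ess_bounded_zero)

lift_definition plus_linf :: "linf \<Rightarrow> linf \<Rightarrow> linf" is "\<lambda>f g t. f t + g t"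
  by (auto simp: ae_rel_def ess_bounded_add)

lift_definition uminus_linf :: "linf \<Rightarrow> linf" is "\<lambda>f t. - f t"
  by (auto simp: ae_rel_def ess_bounded_minus)

lift_definition minus_linf :: "linf \<Rightarrow> linf \<Rightarrow> linf" is "\<lambda>f g t. f t - g t"
  by (auto simp: ae_rel_def ess_bounded_diff)

lift_definition scaleR_linf :: "real \<Rightarrow> linf \<Rightarrow> linf" is "\<lambda>c f t. c * f t"
  by (auto simp: ae_rel_def ess_bounded_scale)

instance
proof
  note ess_bounded_intros = ess_bounded_zero ess_bounded_add ess_bounded_scale
    ess_bounded_minus ess_bounded_diff
  fix f g h :: linf and a b :: real
  show "f + g + h = f + (g + h)"
    by transfer (simp add: ae_rel_def ess_bounded_intros add.assoc)
  show "f + g = g + f"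
    by transfer (simp add: ae_rel_def ess_bounded_intros add.commute)
  show "0 + f = f"
    by transfer (simp add: ae_rel_def)
  show "- f + f = 0"
    by transfer (simp add: ae_rel_def ess_bounded_intros)
  show "f - g = f + - g"
    by transfer (simp add: ae_rel_def ess_bounded_intros)
  show "a *\<^sub>R (f + g) = a *\<^sub>R f + a *\<^sub>R g"
    by transfer (simp add: ae_rel_def ess_bounded_intros distrib_left)
  show "(a + b) *\<^sub>R f = a *\<^sub>R f + b *\<^sub>R f"
    by transfer (simp add: ae_rel_def ess_bounded_intros distrib_right)
  show "a *\<^sub>R b *\<^sub>R f = (a * b) *\<^sub>R f"
    by transfer (simp add: ae_rel_def ess_bounded_intros mult.assoc)
  show "1 *\<^sub>R f = f"
    by transfer (simp add: ae_rel_def)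
qed

end

instantiation linf :: real_normed_vector
begin

lift_definition norm_linf :: "linf \<Rightarrow> real"
  is "\<lambda>f. real_of_ereal (esssup halfline (\<lambda>t. ereal \<bar>f t\<bar>))"
proof -
  fix f g assume "ae_rel f g"
  then have [measurable]: "f \<in> borel_measurable halfline" "g \<in> borel_measurable halfline"
    and ae: "AE t in halfline. f t = g t"
    by (simp_all add: ae_rel_def ess_bounded_def)
  have "esssup halfline (\<lambda>t. ereal \<bar>f t\<bar>) = esssup halfline (\<lambda>t. ereal \<bar>g t\<bar>)"
    by (rule esssup_AE_cong, measurable) (use ae in eventually_elim, simp)
  then show "real_of_ereal (esssup halfline (\<lambda>t. ereal \<bar>f t\<bar>)) =
      real_of_ereal (esssup halfline (\<lambda>t. ereal \<bar>g t\<bar>))"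
    by (rule arg_cong)
qed

definition dist_linf :: "linf \<Rightarrow> linf \<Rightarrow> real" where
  "dist_linf f g = norm (f - g)"

definition sgn_linf :: "linf \<Rightarrow> linf" where
  "sgn_linf f = inverse (norm f) *\<^sub>R f"

definition uniformity_linf :: "(linf \<times> linf) filter" where
  "uniformity_linf = (INF e\<in>{0<..}. principal {(x, y). dist x y < e})"

definition open_linf :: "linf set \<Rightarrow> bool" where
  "open_linf U \<longleftrightarrow> (\<forall>x\<in>U. \<forall>\<^sub>F (x', y) in uniformity. x' = x \<longrightarrow> y \<in> U)"

lemma norm_linf_le:
  assumes "ess_bounded f" "AE t in halfline. \<bar>f t\<bar> \<le> c"
  shows "real_of_ereal (esssup halfline (\<lambda>t. ereal \<bar>f t\<bar>)) \<le> c"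
proof -
  have "esssup halfline (\<lambda>t. ereal \<bar>f t\<bar>) \<le> ereal c"
    using assms by (intro esssup_I) (auto simp: ess_bounded_def)
  then show ?thesis
    using ess_bounded_esssup[OF assms(1)] by (metis ereal_less_eq(3))
qed

lemma norm_linf_nonneg:
  assumes "ess_bounded f"
  shows "0 \<le> real_of_ereal (esssup halfline (\<lambda>t. ereal \<bar>f t\<bar>))"
  using assms esssup_abs_nonneg by (simp add: ess_bounded_def real_of_ereal_pos)

instance
proof
  fix f g :: linf and c :: real
  show "norm f = 0 \<longleftrightarrow> f = 0"
  proof (transfer, safe)
    fix f assume f: "ae_rel f f" "real_of_ereal (esssup halfline (\<lambda>t. ereal \<bar>f t\<bar>)) = 0"
    then show "ae_rel f (\<lambda>_. 0)"
      using ess_bounded_AE[of f] by (auto simp: ae_rel_def ess_bounded_zero)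
  next
    fix f assume f: "ae_rel f f" "ae_rel f (\<lambda>_. 0)"
    then have "real_of_ereal (esssup halfline (\<lambda>t. ereal \<bar>f t\<bar>)) \<le> 0"
      by (intro norm_linf_le) (auto simp: ae_rel_def)
    then show "real_of_ereal (esssup halfline (\<lambda>t. ereal \<bar>f t\<bar>)) = 0"
      by (rule antisym) (use f in \<open>auto simp: ae_rel_def intro: norm_linf_nonneg\<close>)
  qed
  show "norm (f + g) \<le> norm f + norm g"
  proof (transfer)
    fix f g assume fg: "ae_rel f f" "ae_rel g g"
    then have b: "ess_bounded f" "ess_bounded g"
      by (auto simp: ae_rel_def)
    show "real_of_ereal (esssup halfline (\<lambda>t. ereal \<bar>f t + g t\<bar>)) \<le>
      real_of_ereal (esssup halfline (\<lambda>t. ereal \<bar>f t\<bar>)) +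
      real_of_ereal (esssup halfline (\<lambda>t. ereal \<bar>g t\<bar>))"
      by (rule norm_linf_le[OF ess_bounded_add[OF b]],
        use ess_bounded_AE[OF b(1)] ess_bounded_AE[OF b(2)] in eventually_elim) linarith
  qed
  have le: "norm (c *\<^sub>R f) \<le> \<bar>c\<bar> * norm f" for c and f :: linf
  proof (transfer)
    fix c :: real and f assume "ae_rel f f"
    then have b: "ess_bounded f"
      by (auto simp: ae_rel_def)
    show "real_of_ereal (esssup halfline (\<lambda>t. ereal \<bar>c * f t\<bar>)) \<le>
      \<bar>c\<bar> * real_of_ereal (esssup halfline (\<lambda>t. ereal \<bar>f t\<bar>))"
      by (rule norm_linf_le[OF ess_bounded_scale[OF b]],
        use ess_bounded_AE[OF b] in eventually_elim) (simp add: abs_mult mult_left_mono)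
  qed
  show "norm (c *\<^sub>R f) = \<bar>c\<bar> * norm f"
  proof (cases "c = 0")
    case True
    have "0 \<le> norm (c *\<^sub>R f)"
      by (transfer) (auto simp: ae_rel_def intro!: norm_linf_nonneg ess_bounded_scale)
    then show ?thesis
      using True le[of c f] by simp
  next
    case False
    have "norm f = norm (inverse c *\<^sub>R (c *\<^sub>R f))"
      using False by simp
    also have "\<dots> \<le> \<bar>inverse c\<bar> * norm (c *\<^sub>R f)"
      by (rule le)
    finally have "\<bar>c\<bar> * norm f \<le> norm (c *\<^sub>R f)"
      using False by (simp add: field_simps)
    with le[of c f] show ?thesis by simp
  qed
  show "dist f g = norm (f - g)" "sgn f = inverse (norm f) *\<^sub>R f"
    by (fact dist_linf_def sgn_linf_def)+
  show "(uniformity :: (linf \<times> linf) filter) =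
      (INF e\<in>{0<..}. principal {(x, y). dist x y < e})"
    by (fact uniformity_linf_def)
  show "open U \<longleftrightarrow> (\<forall>x\<in>U. \<forall>\<^sub>F (x', y) in uniformity. x' = x \<longrightarrow> y \<in> U)" for U :: "linf set"
    by (fact open_linf_def)
qed

end

section \<open>Limiting averages\<close>

lemma ae_rel_set_integral_eq:
  assumes "ae_rel f g" "A \<in> sets lebesgue" "A \<subseteq> {1..}" "w \<in> borel_measurable borel"
  shows "(LINT t:A|lebesgue. f t * w t) = (LINT t:A|lebesgue. g t * w t)"
proof -
  have *: "(LINT t:A|lebesgue. h t) = (LINT t|halfline. indicator A t *\<^sub>R h t)" for h :: "real \<Rightarrow> real"
  proof -
    have "(LINT t|halfline. indicator A t *\<^sub>R h t) =
        (LINT t|lebesgue. indicator {1..} t *\<^sub>R (indicator A t *\<^sub>R h t))"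
      by (rule integral_restrict_space) simp
    also have "\<dots> = (LINT t|lebesgue. indicator A t *\<^sub>R h t)"
      using assms(3) by (intro Bochner_Integration.integral_cong refl) (auto split: split_indicator)
    finally show ?thesis
      by (simp only: set_lebesgue_integral_def)
  qed
  have [measurable]: "f \<in> borel_measurable halfline" "g \<in> borel_measurable halfline"
    using assms(1) by (auto simp: ae_rel_def ess_bounded_def)
  have [measurable]: "w \<in> borel_measurable halfline"
    using measurable_completion[of w lborel borel] assms(4) by (simp add: measurable_restrict_space1)
  have [measurable]: "A \<in> sets halfline"
    using assms(2,3) by (simp add: sets_restrict_space_iff)
  have ae: "AE t in halfline. f t = g t"
    using assms(1) by (simp add: ae_rel_def)
  show ?thesis
    unfolding * by (rule integral_cong_AE, measurable) (use ae in eventually_elim, simp)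
qed

lift_definition has_mean :: "linf \<Rightarrow> real \<Rightarrow> bool" is
  "\<lambda>f m. ((\<lambda>x. 1 / x * (LINT t:{1..x}|lebesgue. f t)) \<longlongrightarrow> m) at_top"
proof -
  fix f g assume "ae_rel f g"
  then have "(LINT t:{1..x}|lebesgue. f t) = (LINT t:{1..x}|lebesgue. g t)" for x
    using ae_rel_set_integral_eq[of f g "{1..x}" "\<lambda>_. 1"] by auto
  then show "(\<lambda>m. ((\<lambda>x. 1 / x * (LINT t:{1..x}|lebesgue. f t)) \<longlongrightarrow> m) at_top) =
    (\<lambda>m. ((\<lambda>x. 1 / x * (LINT t:{1..x}|lebesgue. g t)) \<longlongrightarrow> m) at_top)"
    by simp
qed

definition E0 :: "linf set" where
  "E0 = {f. has_mean f 0}"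

lift_definition nonneg_linf :: "linf \<Rightarrow> bool" is
  "\<lambda>f. AE t in halfline. 0 \<le> f t"
proof -
  fix f g assume "ae_rel f g"
  then have "AE t in halfline. f t = g t"
    by (simp add: ae_rel_def)
  then have "AE t in halfline. 0 \<le> f t \<longleftrightarrow> 0 \<le> g t"
    by eventually_elim simp
  then show "(AE t in halfline. 0 \<le> f t) = (AE t in halfline. 0 \<le> g t)"
    by (rule eventually_subst)
qed

definition mean_functionals :: "(linf \<Rightarrow>\<^sub>L real) set" where
  "mean_functionals = {\<psi>. (\<forall>f. nonneg_linf f \<longrightarrow> 0 \<le> blinfun_apply \<psi> f) \<and>
     norm \<psi> = 1 \<and> (\<forall>f\<in>E0. blinfun_apply \<psi> f = 0)}"

text \<open>For \<open>x < 1\<close> the inner integral depends on the representative outside the half-line,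
  but the limit superior does not. It is taken in \<^typ>\<open>ereal\<close>, where it always exists.\<close>

lift_definition Qbar :: "linf \<Rightarrow> ereal" is
  "\<lambda>f. Lim (at_right 1) (\<lambda>\<theta>. Limsup at_top
     (\<lambda>x. ereal (1 / ln \<theta> * (LINT t:{x..\<theta> * x}|lebesgue. f t / t))))"
proof -
  fix f g assume fg: "ae_rel f g"
  have "(LINT t:{x..\<theta> * x}|lebesgue. f t / t) = (LINT t:{x..\<theta> * x}|lebesgue. g t / t)"
    if "1 \<le> x" for x \<theta> :: real
    using ae_rel_set_integral_eq[OF fg, of "{x..\<theta> * x}" "\<lambda>t. 1 / t"] that by auto
  then have "Limsup at_top (\<lambda>x. ereal (1 / ln \<theta> * (LINT t:{x..\<theta> * x}|lebesgue. f t / t))) =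
      Limsup at_top (\<lambda>x. ereal (1 / ln \<theta> * (LINT t:{x..\<theta> * x}|lebesgue. g t / t)))" for \<theta>
    by (intro Limsup_eq eventually_mono[OF eventually_ge_at_top[of 1]]) simp
  then show "Lim (at_right 1) (\<lambda>\<theta>. Limsup at_top
      (\<lambda>x. ereal (1 / ln \<theta> * (LINT t:{x..\<theta> * x}|lebesgue. f t / t)))) =
    Lim (at_right 1) (\<lambda>\<theta>. Limsup at_top
      (\<lambda>x. ereal (1 / ln \<theta> * (LINT t:{x..\<theta> * x}|lebesgue. g t / t))))"
    by simp
qed

end

theory Submission
  imports Defs
begin

text \<open>Every \<open>\<psi> \<in> \<C>\<close> is compared with the window averages
  \<open>A\<^sub>\<theta>(x) = (1 / ln \<theta>) \<integral>\<^bsub>[x, \<theta> x]\<^esub> f(t) dt/t\<close>. For fixed \<open>\<theta>\<close>, every cluster point of the functionals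
  \<open>A\<^sub>\<theta>(x)\<close> as \<open>x \<rightarrow> \<infinity>\<close> lies in \<open>\<C>\<close>, which gives
  \<open>limsup\<^sub>x A\<^sub>\<theta>(x) \<le> sup \<psi>(f)\<close> for all \<open>\<theta> > 1\<close>. Conversely, if \<open>limsup\<^sub>x A\<^sub>\<theta>(x) < w\<close> for \<open>\<theta>\<close> arbitrarily
  close to \<open>1\<close>, cut the half-line into blocks whose ratios tend to \<open>1\<close> so slowly that \<open>A \<le> w\<close> still
  holds on them eventually. Replacing \<open>f\<close> by its block averages changes it by an element of \<open>E\<^sub>0\<close>,
  so \<open>\<psi>(f) \<le> w\<close>. Together the two bounds also give the existence of the limit as \<open>\<theta> \<rightarrow> 1\<close>.\<close>

section \<open>Everywhere bounded representatives of classes in L^\<infinity>\<close>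

text \<open>Measurability and the bound are required on the whole line, so that integrals over
  arbitrary intervals can be handled pointwise instead of almost everywhere.\<close>

definition bounded_measurable :: "(real \<Rightarrow> real) \<Rightarrow> real \<Rightarrow> bool" where
  "bounded_measurable f C \<longleftrightarrow> f \<in> borel_measurable lebesgue \<and> (\<forall>t. \<bar>f t\<bar> \<le> C)"

lemma bounded_measurableD:
  assumes "bounded_measurable f C"
  shows "f \<in> borel_measurable lebesgue" "\<bar>f t\<bar> \<le> C" "0 \<le> C"
  using assms abs_ge_zero[of "f t"] order_trans by (auto simp: bounded_measurable_def)

lemma bounded_measurable_add:
  "bounded_measurable f C \<Longrightarrow> bounded_measurable g D \<Longrightarrow> bounded_measurable (\<lambda>t. f t + g t) (C + D)"
  unfolding bounded_measurable_def by (auto intro!: abs_triangle_ineq[THEN order_trans] add_mono)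

lemma bounded_measurable_diff:
  "bounded_measurable f C \<Longrightarrow> bounded_measurable g D \<Longrightarrow> bounded_measurable (\<lambda>t. f t - g t) (C + D)"
  unfolding bounded_measurable_def by (auto intro!: abs_triangle_ineq4[THEN order_trans] add_mono)

lemma bounded_measurable_scale:
  "bounded_measurable f C \<Longrightarrow> bounded_measurable (\<lambda>t. c * f t) (\<bar>c\<bar> * C)"
  unfolding bounded_measurable_def by (auto simp: abs_mult intro!: mult_left_mono)

lemma bounded_measurable_const: "bounded_measurable (\<lambda>_. c) \<bar>c\<bar>"
  by (simp add: bounded_measurable_def)

lemma bounded_measurable_ess_bounded:
  assumes "bounded_measurable f C"
  shows "ess_bounded f"
  using assms by (intro ess_boundedI[where c = C])
    (auto simp: bounded_measurable_def measurable_restrict_space1)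

lemma bounded_measurable_ae_rel: "bounded_measurable f C \<Longrightarrow> ae_rel f f"
  by (simp add: ae_rel_def bounded_measurable_ess_bounded)

text \<open>Setting a representative to 0 below 1 and wherever it exceeds the norm alters it, within
  the half-line, only on a null set, because the norm is an essential supremum.\<close>

lemma linf_bounded_representative:
  obtains g where "bounded_measurable g (norm f)" "f = abs_linf g"
proof
  let ?r = "rep_linf f"
  define g where "g t = (if 1 \<le> t \<and> \<bar>?r t\<bar> \<le> norm f then ?r t else 0)" for t
  have r: "ess_bounded ?r" "abs_linf ?r = f"
    using Quotient3_rep_reflp[OF Quotient3_linf] Quotient3_abs_rep[OF Quotient3_linf]
    by (auto simp: ae_rel_def)
  have n: "norm f = real_of_ereal (esssup halfline (\<lambda>t. ereal \<bar>?r t\<bar>))"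
    by (simp add: norm_linf.rep_eq)
  have [measurable]: "?r \<in> borel_measurable halfline"
    using r by (simp add: ess_bounded_def)
  have "(\<lambda>t. if \<bar>?r t\<bar> \<le> norm f then ?r t else 0) \<in> borel_measurable halfline"
    by measurable
  then have "(\<lambda>t. if t \<in> {1..} then (if \<bar>?r t\<bar> \<le> norm f then ?r t else 0) else 0) \<in> borel_measurable lebesgue"
    by (subst (asm) borel_measurable_if[symmetric]) auto
  also have "(\<lambda>t. if t \<in> {1..} then (if \<bar>?r t\<bar> \<le> norm f then ?r t else 0) else 0) = g"
    by (auto simp: g_def)
  finally have "g \<in> borel_measurable lebesgue" .
  moreover have "\<bar>g t\<bar> \<le> norm f" for t
    by (simp add: g_def)
  ultimately show bm: "bounded_measurable g (norm f)"
    by (simp add: bounded_measurable_def)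
  have "AE t in halfline. ?r t = g t"
    using ess_bounded_AE[OF r(1)] AE_space[of halfline]
    by eventually_elim (simp add: g_def n)
  then have "ae_rel ?r g"
    using r(1) bounded_measurable_ess_bounded[OF bm] by (simp add: ae_rel_def)
  then show "f = abs_linf g"
    using r(2) Quotient3_rel_abs[OF Quotient3_linf] by metis
qed

lemma linf_ops_bounded_measurable:
  assumes "bounded_measurable f C" "bounded_measurable g D"
  shows "abs_linf f + abs_linf g = abs_linf (\<lambda>t. f t + g t)"
    "abs_linf f - abs_linf g = abs_linf (\<lambda>t. f t - g t)"
    "c *\<^sub>R abs_linf f = abs_linf (\<lambda>t. c * f t)"
  using assms[THEN bounded_measurable_ae_rel]
  by (simp_all add: plus_linf.abs_eq minus_linf.abs_eq scaleR_linf.abs_eq)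

lemma norm_abs_linf_le: "bounded_measurable f C \<Longrightarrow> norm (abs_linf f) \<le> C"
  by (subst norm_linf.abs_eq[OF bounded_measurable_ae_rel], assumption)
    (auto intro!: norm_linf_le bounded_measurable_ess_bounded dest: bounded_measurableD)

lemma nonneg_abs_linf: "bounded_measurable f C \<Longrightarrow> (\<And>t. 0 \<le> f t) \<Longrightarrow> nonneg_linf (abs_linf f)"
  by (subst nonneg_linf.abs_eq[OF bounded_measurable_ae_rel]) auto

section \<open>Passage from Lebesgue to Henstock-Kurzweil integrals on intervals\<close>

lemma bounded_measurable_absolutely_integrable:
  assumes "bounded_measurable f C" "continuous_on {a..b} w"
  shows "(\<lambda>t. f t * w t) absolutely_integrable_on {a..b}"
proof (rule absolutely_integrable_bounded_measurable_product_real)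
  show "f \<in> borel_measurable (lebesgue_on {a..b})"
    using assms(1) by (simp add: bounded_measurable_def measurable_restrict_space1)
  show "bounded (f ` {a..b})"
    using assms(1) by (auto simp: bounded_measurable_def bounded_iff)
  show "w absolutely_integrable_on {a..b}"
    using assms(2) by (metis absolutely_integrable_continuous box_real(2))
qed auto

lemma bounded_measurable_integrable: "bounded_measurable f C \<Longrightarrow> f integrable_on {a..b}"
  using bounded_measurable_absolutely_integrable[of f C a b "\<lambda>_. 1"]
  by (auto dest: set_lebesgue_integral_eq_integral(1))

lemma bounded_measurable_divide_absolutely_integrable:
  assumes "bounded_measurable f C" "0 < a"
  shows "(\<lambda>t. f t / t) absolutely_integrable_on {a..b}"
proof -
  have "continuous_on {a..b} (\<lambda>t. 1 / t)"
    using assms(2) by (intro continuous_intros) auto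
  from bounded_measurable_absolutely_integrable[OF assms(1) this] show ?thesis by simp
qed

lemmas bounded_measurable_divide_integrable =
  set_lebesgue_integral_eq_integral(1)[OF bounded_measurable_divide_absolutely_integrable]

lemma abs_integral_le:
  fixes f :: "real \<Rightarrow> real"
  assumes "f integrable_on {a..b}" "\<And>t. t \<in> {a..b} \<Longrightarrow> \<bar>f t\<bar> \<le> B" "a \<le> b"
  shows "\<bar>integral {a..b} f\<bar> \<le> B * (b - a)"
proof -
  have "\<bar>integral {a..b} f\<bar> \<le> integral {a..b} (\<lambda>_. B)"
    using integral_norm_bound_integral[OF assms(1) integrable_const_ivl[of B a b]] assms(2) by auto
  then show ?thesis
    using assms(3) by (simp add: mult.commute)
qed

lemma has_mean_abs_linf:
  assumes "bounded_measurable f C"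
  shows "has_mean (abs_linf f) m \<longleftrightarrow> ((\<lambda>x. integral {1..x} f / x) \<longlongrightarrow> m) at_top"
proof -
  have "(LINT t:{1..x}|lebesgue. f t) = integral {1..x} f" for x
    using set_lebesgue_integral_eq_integral(2)
      bounded_measurable_absolutely_integrable[OF assms, of 1 x "\<lambda>_. 1"] by auto
  then show ?thesis
    by (simp add: has_mean.abs_eq[OF bounded_measurable_ae_rel[OF assms]])
qed

section \<open>Logarithmic window averages as functionals\<close>

text \<open>The clamp \<open>max 1 x\<close> keeps the window inside the half-line, so the value
  depends only on the class for every \<open>x\<close>, provided the window is not empty to begin
  with; limits at infinity do not see it.\<close>

lift_definition log_average :: "real \<Rightarrow> real \<Rightarrow> linf \<Rightarrow> real" is
  "\<lambda>\<theta> x f. 1 / ln \<theta> * (LINT t:{max 1 x..\<theta> * max 1 x}|lebesgue. f t / t)"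
proof -
  fix \<theta> x :: real and f g assume fg: "ae_rel f g"
  show "1 / ln \<theta> * (LINT t:{max 1 x..\<theta> * max 1 x}|lebesgue. f t / t) =
      1 / ln \<theta> * (LINT t:{max 1 x..\<theta> * max 1 x}|lebesgue. g t / t)"
    using ae_rel_set_integral_eq[OF fg, of "{max 1 x..\<theta> * max 1 x}" "\<lambda>t. 1 / t"] by auto
qed

lemma log_average_abs_linf:
  assumes "bounded_measurable f C" "1 \<le> x"
  shows "log_average \<theta> x (abs_linf f) = integral {x..\<theta> * x} (\<lambda>t. f t / t) / ln \<theta>"
  using set_lebesgue_integral_eq_integral(2)[OF
      bounded_measurable_divide_absolutely_integrable[OF assms(1), of x "\<theta> * x"]] assms
  by (simp add: log_average.abs_eq[OF bounded_measurable_ae_rel[OF assms(1)]] max_def)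

lemma Qbar_eq_log_average:
  "Qbar f = Lim (at_right 1) (\<lambda>\<theta>. Limsup at_top (\<lambda>x. ereal (log_average \<theta> x f)))"
proof (transfer, rule arg_cong[where f = "Lim _"], rule ext)
  fix f \<theta>
  show "Limsup at_top (\<lambda>x. ereal (1 / ln \<theta> * (LINT t:{x..\<theta> * x}|lebesgue. f t / t))) =
    Limsup at_top (\<lambda>x. ereal (1 / ln \<theta> * (LINT t:{max 1 x..\<theta> * max 1 x}|lebesgue. f t / t)))"
    by (intro Limsup_eq eventually_mono[OF eventually_ge_at_top[of 1]]) (simp add: max_def)
qed

lemma nonneg_linf_representative:
  assumes "nonneg_linf f"
  obtains g where "bounded_measurable g (norm f)" "\<And>t. 0 \<le> g t" "f = abs_linf g"
proof -
  obtain g where g: "bounded_measurable g (norm f)" "f = abs_linf g"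
    by (rule linf_bounded_representative)
  have bm: "bounded_measurable (\<lambda>t. \<bar>g t\<bar>) (norm f)"
    using g(1) by (auto simp: bounded_measurable_def)
  have "AE t in halfline. 0 \<le> g t"
    using assms unfolding g(2) by (simp add: nonneg_linf.abs_eq[OF bounded_measurable_ae_rel[OF g(1)]])
  then have "AE t in halfline. g t = \<bar>g t\<bar>"
    by eventually_elim simp
  then have "ae_rel g (\<lambda>t. \<bar>g t\<bar>)"
    using bounded_measurable_ess_bounded[OF bm] bounded_measurable_ess_bounded[OF g(1)]
    by (simp add: ae_rel_def)
  then have "f = abs_linf (\<lambda>t. \<bar>g t\<bar>)"
    using g(2) Quotient3_rel_abs[OF Quotient3_linf] by metis
  with bm show ?thesis
    by (intro that) auto
qed

text \<open>Lets later proofs assume a left endpoint of at least 1, where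
  \<open>log_average_abs_linf\<close> applies.\<close>

lemma log_average_max: "log_average \<theta> x f = log_average \<theta> (max 1 x) f"
  by transfer simp

lemma has_integral_reciprocal:
  fixes a b :: real
  assumes "0 < a" "a \<le> b"
  shows "((\<lambda>t. 1 / t) has_integral (ln b - ln a)) {a..b}"
  using assms by (intro fundamental_theorem_of_calculus)
    (auto intro!: derivative_eq_intros simp: has_real_derivative_iff_has_vector_derivative[symmetric])

lemma has_integral_reciprocal_mult:
  fixes x \<theta> :: real
  assumes "0 < x" "1 \<le> \<theta>"
  shows "((\<lambda>t. 1 / t) has_integral ln \<theta>) {x..\<theta> * x}"
  using has_integral_reciprocal[of x "\<theta> * x"] assms by (simp add: ln_mult)

lemma log_average_add:
  "log_average \<theta> x (f + g) = log_average \<theta> x f + log_average \<theta> x g"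
proof -
  obtain u v where uv: "bounded_measurable u (norm f)" "f = abs_linf u"
    "bounded_measurable v (norm g)" "g = abs_linf v"
    using linf_bounded_representative by metis
  show ?thesis
    using bounded_measurable_divide_integrable[OF uv(1), of "max 1 x" "\<theta> * max 1 x"]
      bounded_measurable_divide_integrable[OF uv(3), of "max 1 x" "\<theta> * max 1 x"]
    unfolding log_average_max[of \<theta> x] uv(2,4) linf_ops_bounded_measurable(1)[OF uv(1,3)]
    by (simp add: log_average_abs_linf[OF bounded_measurable_add[OF uv(1,3)]]
        log_average_abs_linf[OF uv(1)] log_average_abs_linf[OF uv(3)]
        add_divide_distrib Henstock_Kurzweil_Integration.integral_add)
qed

lemma log_average_scale: "log_average \<theta> x (c *\<^sub>R f) = c * log_average \<theta> x f"
proof -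
  obtain u where u: "bounded_measurable u (norm f)" "f = abs_linf u"
    using linf_bounded_representative by metis
  show ?thesis
    unfolding log_average_max[of \<theta> x] u(2) linf_ops_bounded_measurable(3)[OF u(1,1)]
    by (simp add: log_average_abs_linf[OF bounded_measurable_scale[OF u(1)]]
        log_average_abs_linf[OF u(1)] flip: times_divide_eq_right)
qed

lemma log_average_nonneg:
  assumes "nonneg_linf f" "1 < \<theta>"
  shows "0 \<le> log_average \<theta> x f"
proof -
  obtain u where u: "bounded_measurable u (norm f)" "\<And>t. 0 \<le> u t" "f = abs_linf u"
    using nonneg_linf_representative[OF assms(1)] by metis
  show ?thesis
    unfolding log_average_max[of \<theta> x] u(3)
    using assms(2) u(2) bounded_measurable_divide_integrable[OF u(1), of "max 1 x" "\<theta> * max 1 x"]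
    by (subst log_average_abs_linf[OF u(1)])
      (auto intro!: divide_nonneg_nonneg Henstock_Kurzweil_Integration.integral_nonneg)
qed

text \<open>The weight 1 / (t ln \<theta>) has total mass 1 on the window, so averaging cannot
  exceed the sup norm. This uniform bound supplies the compactness used for cluster points.\<close>

lemma abs_log_average_le:
  assumes "1 < \<theta>"
  shows "\<bar>log_average \<theta> x f\<bar> \<le> norm f"
proof -
  obtain u where u: "bounded_measurable u (norm f)" "f = abs_linf u"
    using linf_bounded_representative by metis
  let ?S = "{max 1 x..\<theta> * max 1 x}"
  have inv: "((\<lambda>t. norm f * (1 / t)) has_integral (norm f * ln \<theta>)) ?S"
    using assms by (intro has_integral_mult_right has_integral_reciprocal_mult) auto
  have "\<bar>u t / t\<bar> \<le> norm f * (1 / t)" if "t \<in> ?S" for t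
    using that bounded_measurableD(2)[OF u(1), of t] by (auto simp: abs_divide divide_right_mono)
  then have "\<bar>integral ?S (\<lambda>t. u t / t)\<bar> \<le> integral ?S (\<lambda>t. norm f * (1 / t))"
    using integral_norm_bound_integral[OF bounded_measurable_divide_integrable[OF u(1), of "max 1 x" "\<theta> * max 1 x"]
        has_integral_integrable[OF inv]] by auto
  also have "\<dots> = norm f * ln \<theta>"
    using inv by (rule integral_unique)
  finally show ?thesis
    using assms unfolding log_average_max[of \<theta> x] u(2)
    by (subst log_average_abs_linf[OF u(1)]) (auto simp: abs_divide divide_le_eq)
qed

lemma log_average_one: "1 < \<theta> \<Longrightarrow> log_average \<theta> x (abs_linf (\<lambda>_. 1)) = 1"
  unfolding log_average_max[of \<theta> x]
  using integral_unique[OF has_integral_reciprocal_mult[of "max 1 x" \<theta>]]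
  by (subst log_average_abs_linf[OF bounded_measurable_const]) auto

text \<open>Integration by parts is replaced by the second mean value theorem, since the
  antiderivative of \<open>f\<close> is differentiable only almost everywhere.\<close>

lemma log_average_E0_tendsto:
  assumes "f \<in> E0" "1 < \<theta>"
  shows "((\<lambda>x. log_average \<theta> x f) \<longlongrightarrow> 0) at_top"
proof -
  obtain u where u: "bounded_measurable u (norm f)" "f = abs_linf u"
    using linf_bounded_representative by metis
  define F where "F x = integral {1..x} u" for x
  have ui: "u integrable_on {a..b}" for a b
    by (rule bounded_measurable_integrable[OF u(1)])
  have F: "((\<lambda>x. F x / x) \<longlongrightarrow> 0) at_top"
    using assms(1) unfolding E0_def u(2) F_def by (simp add: has_mean_abs_linf[OF u(1)])
  have F_diff: "integral {a..b} u = F b - F a" if "1 \<le> a" "a \<le> b" for a b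
    using Henstock_Kurzweil_Integration.integral_combine[OF that ui] by (simp add: F_def)
  \<comment> \<open>If the primitive is at most \<open>e * y\<close> in size past \<open>x\<close>,
    its increments over the two pieces of the window are at most
    \<open>e * (\<theta> + 1) * x\<close> and \<open>2 * e * \<theta> * x\<close>. The weights 1/x
    and 1/(\<theta> x) turn these into \<open>e * (\<theta> + 1)\<close> and \<open>2 * e\<close>,
    whence \<open>\<theta> + 3\<close>.\<close>
  have bound: "\<bar>log_average \<theta> x f\<bar> \<le> e * (\<theta> + 3) / ln \<theta>"
    if x: "1 \<le> x" and e: "\<And>y. x \<le> y \<Longrightarrow> \<bar>F y\<bar> \<le> e * y" for x e
  proof -
    have le: "x \<le> \<theta> * x"
      using assms(2) x by simp
    have "0 \<le> e * x"
      using e[of x] by linarith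
    then have e0: "0 \<le> e"
      using x by (simp add: zero_le_mult_iff)
    \<comment> \<open>The second mean value theorem is applied to a nondecreasing weight, so 1/t
      enters with a minus sign, which is removed again in the next step.\<close>
    obtain c where c: "c \<in> {x..\<theta> * x}" and
      eq: "integral {x..\<theta> * x} (\<lambda>t. - (1 / t) * u t) =
        - (1 / x) * integral {x..c} u + - (1 / (\<theta> * x)) * integral {c..\<theta> * x} u"
      by (rule second_mean_value_theorem[of u x "\<theta> * x" "\<lambda>t. - (1 / t)"])
        (use ui le x in \<open>auto intro!: divide_left_mono\<close>)
    have I: "integral {x..\<theta> * x} (\<lambda>t. u t / t) =
        (F c - F x) / x + (F (\<theta> * x) - F c) / (\<theta> * x)"
      using eq F_diff[of x c] F_diff[of c "\<theta> * x"] c x by auto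
    have c': "x \<le> c" "c \<le> \<theta> * x"
      using c by auto
    note ec = mult_left_mono[OF c'(2) e0]
    have "\<bar>F c - F x\<bar> \<le> e * (\<theta> * x) + e * x"
      using e[OF c'(1)] e[OF order_refl] ec by linarith
    then have 1: "\<bar>(F c - F x) / x\<bar> \<le> e * \<theta> + e"
      using x by (auto simp: abs_divide divide_le_eq algebra_simps)
    have "\<bar>F (\<theta> * x) - F c\<bar> \<le> e * (\<theta> * x) + e * (\<theta> * x)"
      using e[OF c'(1)] e[OF le] ec by linarith
    then have 2: "\<bar>(F (\<theta> * x) - F c) / (\<theta> * x)\<bar> \<le> 2 * e"
      using x assms(2) by (auto simp: abs_divide divide_le_eq algebra_simps)
    have "\<bar>integral {x..\<theta> * x} (\<lambda>t. u t / t)\<bar> \<le> e * (\<theta> + 3)"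
      using 1 2 unfolding I distrib_left by linarith
    then show ?thesis
      using assms(2) unfolding u(2) log_average_abs_linf[OF u(1) x]
      by (simp add: abs_divide divide_right_mono)
  qed
  show ?thesis
  proof (rule tendstoI)
    fix e :: real assume "0 < e"
    define d where "d = e / 2 * ln \<theta> / (\<theta> + 3)"
    have pos: "0 < ln \<theta>" "0 < \<theta> + 3"
      using assms(2) by auto
    then have d1: "0 < d"
      using \<open>0 < e\<close> by (simp add: d_def)
    have "d * (\<theta> + 3) / ln \<theta> = e / 2"
      using pos by (simp add: d_def del: distrib_left_numeral)
    also have "\<dots> < e"
      using \<open>0 < e\<close> by simp
    finally have d2: "d * (\<theta> + 3) / ln \<theta> < e" .
    have "eventually (\<lambda>x. dist (F x / x) 0 < d) at_top"
      using F d1 by (rule tendstoD)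
    then obtain X where X: "\<And>x. X \<le> x \<Longrightarrow> \<bar>F x / x\<bar> < d"
      by (auto simp: eventually_at_top_linorder dist_real_def)
    have "\<bar>log_average \<theta> x f\<bar> < e" if "max X 1 \<le> x" for x
    proof -
      have "\<bar>F y\<bar> \<le> d * y" if "x \<le> y" for y
        using X[of y] that \<open>max X 1 \<le> x\<close> by (auto simp: abs_divide divide_less_eq)
      then show ?thesis
        using bound[of x d] that d2 by fastforce
    qed
    then show "eventually (\<lambda>x. dist (log_average \<theta> x f) 0 < e) at_top"
      by (auto simp: eventually_at_top_linorder intro!: exI[of _ "max X 1"])
  qed
qed

lemma norm_one_linf_le: "norm (abs_linf (\<lambda>_. 1)) \<le> 1"
  using norm_abs_linf_le[OF bounded_measurable_const, of 1] by simp

section \<open>Lower bound: cluster points of window averages\<close>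

text \<open>A Banach-Alaoglu argument: the averages lie in a compact product of intervals and
  therefore have a pointwise cluster point along those \<open>x\<close> where the average of
  \<open>f\<close> exceeds \<open>a\<close>. Linearity, positivity, the bound by the norm, the value
  at 1 and vanishing on \<open>E0\<close> all survive the limit.\<close>

lemma mean_functional_ge_frequent_log_average:
  assumes "1 < \<theta>" and freq: "\<exists>\<^sub>F x in at_top. a < log_average \<theta> x f"
  shows "\<exists>\<psi>\<in>mean_functionals. a \<le> blinfun_apply \<psi> f"
proof -
  define G where "G = inf at_top (principal {x. a < log_average \<theta> x f})"
  have G: "G \<noteq> bot" "G \<le> at_top"
    using freq by (auto simp: G_def trivial_limit_def eventually_inf_principal frequently_def)
  have Ga: "eventually (\<lambda>x. a < log_average \<theta> x f) G"
    by (simp add: G_def eventually_inf_principal)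
  \<comment> \<open>Compactness of this set is Tychonoff's theorem in the topology of pointwise
    convergence.\<close>
  define K where "K = (\<Pi>\<^sub>E h\<in>(UNIV :: linf set). {- norm h..norm h})"
  have "compactin euclidean K"
    unfolding K_def euclidean_product_topology[symmetric] compactin_PiE by auto
  then have "compact K"
    by simp
  moreover have "filtermap (log_average \<theta>) G \<noteq> bot"
    using G(1) by (simp add: filtermap_bot_iff)
  moreover have "log_average \<theta> x \<in> K" for x
    using abs_log_average_le[OF assms(1)] by (auto simp: K_def abs_le_iff minus_le_iff)
  then have "eventually (\<lambda>l. l \<in> K) (filtermap (log_average \<theta>) G)"
    by (simp add: eventually_filtermap)
  ultimately obtain \<phi> where \<phi>: "\<phi> \<in> K" "inf (nhds \<phi>) (filtermap (log_average \<theta>) G) \<noteq> bot"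
    unfolding compact_filter by blast
  \<comment> \<open>\<open>H\<close> refines both filters: along it functionals converge pointwise
    to \<open>\<phi>\<close>, and whatever holds eventually for the averages along \<open>G\<close>
    holds eventually along \<open>H\<close>.\<close>
  define H where "H = inf (nhds \<phi>) (filtermap (log_average \<theta>) G)"
  have H: "H \<noteq> bot" "H \<le> nhds \<phi>" "H \<le> filtermap (log_average \<theta>) G"
    using \<phi>(2) by (auto simp: H_def)
  have lim: "((\<lambda>l. l h) \<longlongrightarrow> \<phi> h) H" for h
  proof -
    have "((\<lambda>l. l h) \<longlongrightarrow> \<phi> h) (nhds \<phi>)"
    proof (rule topological_tendstoI)
      fix U assume "open U" "\<phi> h \<in> U"
      then show "eventually (\<lambda>l. l h \<in> U) (nhds \<phi>)"
        using open_vimage[OF _ continuous_on_product_coordinates, of U h]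
        by (auto simp: eventually_nhds intro!: exI[of _ "(\<lambda>l. l h) -` U"])
    qed
    then show ?thesis
      using H(2) by (rule tendsto_mono[rotated])
  qed
  have evH: "eventually P H" if "eventually (\<lambda>x. P (log_average \<theta> x)) G" for P
    using H(3) that by (auto simp: le_filter_def eventually_filtermap)
  have add: "\<phi> (h + k) = \<phi> h + \<phi> k" for h k
  proof (rule tendsto_unique[OF H(1) lim])
    show "((\<lambda>l. l (h + k)) \<longlongrightarrow> \<phi> h + \<phi> k) H"
      by (rule Lim_transform_eventually[OF tendsto_add[OF lim lim]])
        (auto intro!: evH simp: log_average_add)
  qed
  have scale: "\<phi> (c *\<^sub>R h) = c * \<phi> h" for c h
  proof (rule tendsto_unique[OF H(1) lim])
    show "((\<lambda>l. l (c *\<^sub>R h)) \<longlongrightarrow> c * \<phi> h) H"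
      by (rule Lim_transform_eventually[OF tendsto_mult_left[OF lim]])
        (auto intro!: evH simp: log_average_scale)
  qed
  have le: "\<bar>\<phi> h\<bar> \<le> norm h" for h
    using \<phi>(1) by (auto simp: K_def abs_le_iff PiE_iff minus_le_iff)
  have "bounded_linear \<phi>"
    using add scale le by (intro bounded_linear_intro[where K = 1]) auto
  then obtain \<psi> where \<psi>: "\<phi> = blinfun_apply \<psi>"
    by (metis bounded_linear_Blinfun_apply)
  have "0 \<le> \<phi> h" if "nonneg_linf h" for h
    by (rule tendsto_lowerbound[OF lim _ H(1)]) (intro evH always_eventually allI log_average_nonneg that assms(1))
  moreover have "\<phi> h = 0" if "h \<in> E0" for h
  proof (rule tendsto_unique[OF H(1) lim])
    have "((\<lambda>l. l h) \<longlongrightarrow> 0) (filtermap (log_average \<theta>) G)"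
      using log_average_E0_tendsto[OF that assms(1)] G(2)
      by (auto simp: filterlim_filtermap intro: tendsto_mono)
    then show "((\<lambda>l. l h) \<longlongrightarrow> 0) H"
      using H(3) by (rule tendsto_mono[rotated])
  qed
  moreover have "norm \<psi> = 1"
  proof (rule antisym)
    show "norm \<psi> \<le> 1"
      using le by (intro norm_blinfun_bound) (auto simp: \<psi>)
    have "\<phi> (abs_linf (\<lambda>_. 1)) = 1"
    proof (rule tendsto_unique[OF H(1) lim])
      show "((\<lambda>l. l (abs_linf (\<lambda>_. 1))) \<longlongrightarrow> 1) H"
        by (rule Lim_transform_eventually[OF tendsto_const])
          (auto intro!: evH simp: log_average_one assms(1))
    qed
    then have "1 \<le> norm \<psi> * norm (abs_linf (\<lambda>_. 1))"
      using norm_blinfun[of \<psi> "abs_linf (\<lambda>_. 1)"] by (simp add: \<psi>)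
    also have "\<dots> \<le> norm \<psi> * 1"
      by (intro mult_left_mono norm_one_linf_le) auto
    finally show "1 \<le> norm \<psi>"
      by simp
  qed
  moreover have "a \<le> \<phi> f"
    by (rule tendsto_lowerbound[OF lim _ H(1)])
      (auto intro!: evH eventually_mono[OF Ga])
  ultimately show ?thesis
    by (auto simp: mean_functionals_def \<psi>)
qed

section \<open>Upper bound: blocks with ratios tending to 1\<close>

text \<open>A diagonal choice: take \<theta>_k tending to 1, each valid beyond a threshold X_k, and
  at \<open>x\<close> use the largest index whose threshold has been passed. The last conclusion
  keeps \<tau> from approaching 1 too fast, so that iterating x -> \<tau>(x) x advances by at least
  1.\<close>

lemma slowly_varying_selection:
  fixes P :: "real \<Rightarrow> real \<Rightarrow> bool"
  assumes "\<exists>\<^sub>F \<theta> in at_right 1. \<forall>\<^sub>F x in at_top. P \<theta> x"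
  obtains \<tau> where "(\<tau> \<longlongrightarrow> 1) at_top" "\<forall>\<^sub>F x in at_top. P (\<tau> x) x"
    "\<forall>\<^sub>F x in at_top. 1 + 1 / x \<le> \<tau> x"
proof -
  have "\<exists>\<theta>>1. \<theta> < 1 + 1 / real (Suc k) \<and> (\<forall>\<^sub>F x in at_top. P \<theta> x)" for k
  proof -
    have "\<forall>\<^sub>F \<theta> in at_right 1. 1 < \<theta> \<and> \<theta> < 1 + 1 / real (Suc k)"
      unfolding eventually_at_right_field by (intro exI[of _ "1 + 1 / real (Suc k)"]) auto
    from frequently_ex[OF frequently_eventually_frequently[OF assms this]] show ?thesis
      by blast
  qed
  then obtain \<theta> where \<theta>: "\<And>k. 1 < \<theta> k" "\<And>k. \<theta> k < 1 + 1 / real (Suc k)"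
    "\<And>k. \<forall>\<^sub>F x in at_top. P (\<theta> k) x"
    by metis
  \<comment> \<open>The bound \<open>real k\<close> makes only finitely many thresholds lie below a
    given \<open>x\<close>; the bound \<open>1 / (\<theta> k - 1)\<close> yields the unit
    advance.\<close>
  have "\<exists>X\<ge>real k. 1 / (\<theta> k - 1) \<le> X \<and> (\<forall>x\<ge>X. P (\<theta> k) x)" for k
  proof -
    obtain Y where "\<forall>x\<ge>Y. P (\<theta> k) x"
      using \<theta>(3)[of k] by (auto simp: eventually_at_top_linorder)
    then show ?thesis
      by (intro exI[of _ "max (max Y (real k)) (1 / (\<theta> k - 1))"]) auto
  qed
  then obtain X where X: "\<And>k. real k \<le> X k" "\<And>k. 1 / (\<theta> k - 1) \<le> X k"
    "\<And>k x. X k \<le> x \<Longrightarrow> P (\<theta> k) x"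
    by metis
  \<comment> \<open>The maximum is guaranteed to be over a nonempty set once
    \<open>X 0 \<le> x\<close>. The thresholds need not be monotone.\<close>
  define \<kappa> where "\<kappa> x = Max {k. X k \<le> x}" for x
  have fin: "finite {k. X k \<le> x}" for x
  proof (rule finite_subset)
    show "{k. X k \<le> x} \<subseteq> {..nat \<lfloor>x\<rfloor>}"
      using order_trans[OF X(1)] by (auto intro!: le_nat_floor)
  qed auto
  have X\<kappa>: "X (\<kappa> x) \<le> x" if "X 0 \<le> x" for x
    using Max_in[OF fin[of x]] that by (auto simp: \<kappa>_def)
  have ge: "k \<le> \<kappa> x" if "X k \<le> x" for k x
    using Max_ge[OF fin[of x], of k] that by (auto simp: \<kappa>_def)
  show ?thesis
  proof (rule that[of "\<lambda>x. \<theta> (\<kappa> x)"])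
    show "((\<lambda>x. \<theta> (\<kappa> x)) \<longlongrightarrow> 1) at_top"
    proof (rule tendstoI)
      fix e :: real assume "0 < e"
      then obtain k where k: "1 / real (Suc k) < e"
        using nat_approx_posE by metis
      have "dist (\<theta> (\<kappa> x)) 1 < e" if "X k \<le> x" for x
      proof -
        have "1 / real (Suc (\<kappa> x)) \<le> 1 / real (Suc k)"
          using ge[OF that] by (intro divide_left_mono) auto
        then show ?thesis
          using \<theta>(1,2)[of "\<kappa> x"] k by (auto simp: dist_real_def)
      qed
      then show "\<forall>\<^sub>F x in at_top. dist (\<theta> (\<kappa> x)) 1 < e"
        by (auto simp: eventually_at_top_linorder)
    qed
    show "\<forall>\<^sub>F x in at_top. P (\<theta> (\<kappa> x)) x"
      using X\<kappa> X(3) by (auto simp: eventually_at_top_linorder intro!: exI[of _ "X 0"])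
    show "\<forall>\<^sub>F x in at_top. 1 + 1 / x \<le> \<theta> (\<kappa> x)"
    proof (rule eventually_at_top_linorderI)
      fix x assume x: "max 1 (X 0) \<le> x"
      then have "1 / (\<theta> (\<kappa> x) - 1) \<le> x"
        using X\<kappa>[of x] X(2)[of "\<kappa> x"] by linarith
      then show "1 + 1 / x \<le> \<theta> (\<kappa> x)"
        using \<theta>(1)[of "\<kappa> x"] x by (auto simp: field_simps)
    qed
  qed
qed

lemma mono_of_unit_steps:
  fixes x :: "nat \<Rightarrow> real"
  assumes "\<And>n. x n + 1 \<le> x (Suc n)"
  shows "mono x" "filterlim x at_top sequentially"
proof -
  show "mono x"
  proof (rule incseq_SucI)
    show "x n \<le> x (Suc n)" for n
      using assms[of n] by simp
  qed
  have "x 0 + real n \<le> x n" for n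
  proof (induction n)
    case (Suc n)
    then show ?case
      using assms[of n] by simp
  qed simp
  moreover have "filterlim (\<lambda>n. x 0 + real n) at_top sequentially"
    by (rule filterlim_tendsto_add_at_top[OF tendsto_const filterlim_real_sequentially])
  ultimately show "filterlim x at_top sequentially"
    by (auto intro: filterlim_at_top_mono)
qed

text \<open>Minimality of the index gives the left bound by excluding the preceding block; at index
  0 the assumption on \<open>x 0\<close> takes its place.\<close>

lemma ex_block_index:
  fixes x :: "nat \<Rightarrow> real"
  assumes "filterlim x at_top sequentially" "x 0 \<le> t"
  shows "x (LEAST n. t < x (Suc n)) \<le> t" "t < x (Suc (LEAST n. t < x (Suc n)))"
proof -
  have "\<forall>\<^sub>F n in sequentially. t < x n"
    using assms(1) by (simp add: filterlim_at_top_dense)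
  then have "\<exists>n. t < x (Suc n)"
    by (auto simp: eventually_sequentially intro: le_SucI)
  then show "t < x (Suc (LEAST n. t < x (Suc n)))"
    by (rule LeastI_ex)
  show "x (LEAST n. t < x (Suc n)) \<le> t"
  proof (cases "LEAST n. t < x (Suc n)")
    case 0
    then show ?thesis using assms(2) by simp
  next
    case (Suc m)
    then have "\<not> t < x (Suc m)"
      using not_less_Least[of m "\<lambda>n. t < x (Suc n)"] by simp
    then show ?thesis using Suc by simp
  qed
qed

text \<open>Complete blocks cancel, so the integral up to \<open>t\<close> is a fixed initial part
  plus one incomplete block. As the ratios tend to 1, that block has length o(t), and boundedness of
  \<open>h\<close> makes its contribution negligible.\<close>

lemma mean_zero_of_blocks:
  fixes x :: "nat \<Rightarrow> real"
  assumes h: "bounded_measurable h C"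
    and x0: "1 \<le> x 0" and step: "\<And>n. x n + 1 \<le> x (Suc n)"
    and ratio: "(\<lambda>n. x (Suc n) / x n) \<longlonglongrightarrow> 1"
    and zero: "\<And>n. integral {x n..x (Suc n)} h = 0"
  shows "has_mean (abs_linf h) 0"
proof -
  note hi = bounded_measurable_integrable[OF h]
  note mono = monoD[OF mono_of_unit_steps(1)[of x, OF step]]
  have C: "0 \<le> C"
    using bounded_measurableD(3)[OF h] .
  define D where "D = \<bar>integral {1..x 0} h\<bar>"
  have x1: "1 \<le> x n" for n
    using mono[of 0 n] x0 by simp
  have prefix: "integral {1..x n} h = integral {1..x 0} h" for n
  proof (induction n)
    case (Suc n)
    then show ?case
      using Henstock_Kurzweil_Integration.integral_combine[OF _ _ hi, of 1 "x n" "x (Suc n)"]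
        x1[of n] step[of n] zero[of n] by simp
  qed simp
  have bound: "\<bar>integral {1..t} h / t\<bar> \<le> D / t + C * d"
    if M: "\<And>n. M \<le> n \<Longrightarrow> x (Suc n) / x n \<le> 1 + d" and t: "x M \<le> t" for M d t
  proof -
    have "x 0 \<le> t"
      using t mono[of 0 M] by simp
    then obtain n where n: "x n \<le> t" "t < x (Suc n)"
      using ex_block_index[OF mono_of_unit_steps(2)[of x, OF step]] by metis
    have "M \<le> n"
    proof (rule ccontr)
      assume "\<not> M \<le> n"
      then have "x (Suc n) \<le> x M"
        by (intro mono) auto
      then show False using n t by simp
    qed
    then have dx: "x (Suc n) - x n \<le> d * x n"
      using M[of n] x1[of n] by (simp add: divide_le_eq algebra_simps)
    then have "0 < d * x n"
      using step[of n] by linarith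
    then have d: "0 \<le> d"
      using x1[of n] by (simp add: zero_less_mult_iff)
    have "t - x n \<le> d * t"
      using n dx mult_left_mono[OF n(1) d] by linarith
    moreover have "\<bar>integral {x n..t} h\<bar> \<le> C * (t - x n)"
      using hi bounded_measurableD(2)[OF h] n(1) by (intro abs_integral_le) auto
    ultimately have "\<bar>integral {x n..t} h\<bar> \<le> C * (d * t)"
      using mult_left_mono[of "t - x n" "d * t", OF _ C] by linarith
    moreover have "integral {1..t} h = integral {1..x 0} h + integral {x n..t} h"
      using Henstock_Kurzweil_Integration.integral_combine[OF _ _ hi, of 1 "x n" t] x1[of n] n(1)
      by (simp add: prefix[of n])
    ultimately have "\<bar>integral {1..t} h\<bar> \<le> D + C * d * t"
      unfolding D_def mult.assoc by linarith
    moreover have "0 < t"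
      using n x1[of n] by simp
    ultimately show ?thesis
      by (simp add: abs_divide divide_le_eq distrib_right)
  qed
  have "((\<lambda>t. integral {1..t} h / t) \<longlongrightarrow> 0) at_top"
  proof (rule tendstoI)
    fix e :: real assume e: "0 < e"
    \<comment> \<open>The incomplete block contributes at most \<open>C * d \<le> e / 2\<close>;
      \<open>C + 1\<close> avoids dividing by zero. The initial part is later made smaller than
      \<open>e / 4\<close>.\<close>
    define d where "d = e / (2 * (C + 1))"
    have "0 < d"
      using e C by (simp add: d_def)
    have d: "C * d < e / 2 + e / 4"
    proof -
      have "C * d \<le> (C + 1) * d" using \<open>0 < d\<close> by simp
      also have "\<dots> = e / 2" using C by (simp add: d_def del: distrib_left_numeral)
      finally show ?thesis using e by simp
    qed
    have "\<forall>\<^sub>F n in sequentially. x (Suc n) / x n < 1 + d"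
      using ratio \<open>0 < d\<close> by (intro order_tendstoD(2)) auto
    then obtain M where M: "\<And>n. M \<le> n \<Longrightarrow> x (Suc n) / x n \<le> 1 + d"
      by (auto simp: eventually_sequentially intro: less_imp_le)
    have "((\<lambda>t. D / t) \<longlongrightarrow> 0) at_top"
      by (intro tendsto_divide_0[OF tendsto_const] filterlim_at_top_imp_at_infinity filterlim_ident)
    then have "\<forall>\<^sub>F t in at_top. D / t < e / 4"
      using e by (intro order_tendstoD(2)) auto
    then show "\<forall>\<^sub>F t in at_top. dist (integral {1..t} h / t) 0 < e"
      using eventually_ge_at_top[of "x M"]
    proof eventually_elim
      case (elim t)
      have "\<bar>integral {1..t} h / t\<bar> \<le> D / t + C * d"
        using M elim(2) by (rule bound)
      then show ?case
        using elim(1) d unfolding dist_real_def diff_0_right by linarith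
    qed
  qed
  then show ?thesis
    by (simp add: has_mean_abs_linf[OF h])
qed

text \<open>Since f is at most its norm times the constant 1, positivity bounds the norm of
  \<open>\<psi>\<close> by its value at 1; the reverse bound comes from the norm of the
  constant.\<close>

lemma mean_functional_one:
  assumes "\<psi> \<in> mean_functionals"
  shows "blinfun_apply \<psi> (abs_linf (\<lambda>_. 1)) = 1"
proof -
  let ?one = "abs_linf (\<lambda>_. 1)"
  interpret \<psi>: bounded_linear "blinfun_apply \<psi>"
    by (rule blinfun.bounded_linear_right)
  have pos: "0 \<le> blinfun_apply \<psi> f" if "nonneg_linf f" for f
    using assms that by (auto simp: mean_functionals_def)
  have le: "blinfun_apply \<psi> f \<le> norm f * blinfun_apply \<psi> ?one" for f
  proof -
    define C where "C = norm f"
    obtain u where u: "bounded_measurable u C" "f = abs_linf u"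
      unfolding C_def using linf_bounded_representative by metis
    have one: "bounded_measurable (\<lambda>t. C * 1) (\<bar>C\<bar> * \<bar>1\<bar>)"
      by (intro bounded_measurable_scale bounded_measurable_const)
    have "nonneg_linf (C *\<^sub>R ?one - f)"
      unfolding u(2) linf_ops_bounded_measurable(3)[OF bounded_measurable_const bounded_measurable_const]
        linf_ops_bounded_measurable(2)[OF one u(1)]
      using bounded_measurableD(2)[OF u(1)]
      by (intro nonneg_abs_linf[OF bounded_measurable_diff[OF one u(1)]]) (auto simp: abs_le_iff)
    from pos[OF this] show ?thesis
      by (simp add: \<psi>.diff \<psi>.scaleR C_def)
  qed
  have "\<bar>blinfun_apply \<psi> f\<bar> \<le> blinfun_apply \<psi> ?one * norm f" for f
    using le[of f] le[of "- f"] by (simp add: blinfun.minus_right mult.commute abs_le_iff)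
  moreover have "nonneg_linf ?one"
    by (rule nonneg_abs_linf[OF bounded_measurable_const]) auto
  ultimately have "norm \<psi> \<le> blinfun_apply \<psi> ?one"
    by (intro norm_blinfun_bound pos) auto
  moreover have "blinfun_apply \<psi> ?one \<le> norm \<psi> * norm ?one"
    using norm_blinfun[of \<psi> ?one] by simp
  moreover have "norm \<psi> = 1"
    using assms by (simp add: mean_functionals_def)
  ultimately show ?thesis
    using norm_one_linf_le by simp
qed

text \<open>The window sizes must shrink along the blocks: for blocks of a fixed ratio \<open>\<theta>\<close> the
  difference between \<open>f\<close> and its block averages need not have mean \<open>0\<close>.\<close>

lemma mean_functional_le_frequent_log_average:
  assumes \<psi>: "\<psi> \<in> mean_functionals"
    and freq: "\<exists>\<^sub>F \<theta> in at_right 1. \<forall>\<^sub>F x in at_top. log_average \<theta> x f \<le> w"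
  shows "blinfun_apply \<psi> f \<le> w"
proof (rule field_le_epsilon)
  fix e :: real assume e: "0 < e"
  let ?one = "abs_linf (\<lambda>_. 1)"
  obtain u C where uC: "bounded_measurable u C" and u: "f = abs_linf u"
    using linf_bounded_representative by metis
  note ui = bounded_measurable_integrable[OF uC]
  have uw: "\<bar>u t - w\<bar> \<le> C + \<bar>w\<bar>" for t
    using bounded_measurableD(2)[OF uC, of t] by linarith
  obtain \<tau> where \<tau>: "(\<tau> \<longlongrightarrow> 1) at_top" "\<forall>\<^sub>F x in at_top. log_average (\<tau> x) x f \<le> w"
    "\<forall>\<^sub>F x in at_top. 1 + 1 / x \<le> \<tau> x"
    using freq by (rule slowly_varying_selection)
  \<comment> \<open>This quantity bounds the error of replacing the logarithmic average over a block
    by the plain average, when compared with \<open>w\<close>.\<close>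
  have "((\<lambda>x. (C + \<bar>w\<bar>) * (\<tau> x - 1)) \<longlongrightarrow> (C + \<bar>w\<bar>) * (1 - 1)) at_top"
    by (intro tendsto_intros \<tau>(1))
  then have "\<forall>\<^sub>F x in at_top. (C + \<bar>w\<bar>) * (\<tau> x - 1) < e"
    using e by (intro order_tendstoD(2)) auto
  then have "\<forall>\<^sub>F x in at_top. (C + \<bar>w\<bar>) * (\<tau> x - 1) \<le> e \<and> log_average (\<tau> x) x f \<le> w \<and> 1 + 1 / x \<le> \<tau> x"
    using \<tau>(2,3) by eventually_elim auto
  then obtain X where X: "\<And>x. X \<le> x \<Longrightarrow>
      (C + \<bar>w\<bar>) * (\<tau> x - 1) \<le> e \<and> log_average (\<tau> x) x f \<le> w \<and> 1 + 1 / x \<le> \<tau> x"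
    by (auto simp: eventually_at_top_linorder)
  \<comment> \<open>The orbit of y -> \<tau>(y) y makes each block exactly the window of the average
    selected at its left endpoint.\<close>
  define x where "x n = ((\<lambda>y. \<tau> y * y) ^^ n) (max 1 X)" for n
  have x_Suc: "x (Suc n) = \<tau> (x n) * x n" for n
    by (simp add: x_def)
  have x_ge: "1 \<le> x n \<and> X \<le> x n" for n
  proof (induction n)
    case (Suc n)
    then have "0 \<le> 1 / x n" "1 + 1 / x n \<le> \<tau> (x n)"
      using X[of "x n"] by auto
    then have "1 * x n \<le> \<tau> (x n) * x n"
      using Suc by (intro mult_right_mono) linarith+
    then show ?case
      using Suc x_Suc[of n] by linarith
  qed (simp add: x_def)
  have step: "x n + 1 \<le> x (Suc n)" for n
  proof -
    have "(1 + 1 / x n) * x n \<le> \<tau> (x n) * x n"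
      using X[of "x n"] x_ge[of n] by (intro mult_right_mono) auto
    then show ?thesis using x_ge[of n] by (simp add: x_Suc distrib_right)
  qed
  note lim = mono_of_unit_steps(2)[of x, OF step]
  have ratio: "(\<lambda>n. x (Suc n) / x n) \<longlonglongrightarrow> 1"
  proof (rule Lim_transform_eventually[OF filterlim_compose[OF \<tau>(1) lim]])
    show "\<forall>\<^sub>F n in sequentially. \<tau> (x n) = x (Suc n) / x n"
      using x_ge by (intro always_eventually allI) (metis x_Suc nonzero_mult_div_cancel_right not_one_le_zero)
  qed
  define b where "b n = integral {x n..x (Suc n)} u / (x (Suc n) - x n)" for n
  have b_abs: "\<bar>b n\<bar> \<le> C" for n
    using abs_integral_le[OF ui, of "x n" "x (Suc n)" C] bounded_measurableD(2)[OF uC] step[of n]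
    by (simp add: b_def abs_divide divide_le_eq)
  have b_le: "b n \<le> w + e" for n
  proof -
    let ?I = "{x n..x (Suc n)}" and ?t = "\<tau> (x n)"
    have xn: "1 \<le> x n" "x n < x (Suc n)"
      using x_ge[of n] step[of n] by auto
    have Xn: "(C + \<bar>w\<bar>) * (?t - 1) \<le> e" "log_average ?t (x n) f \<le> w" "1 + 1 / x n \<le> ?t"
      using X[of "x n"] x_ge[of n] by auto
    have "0 < 1 / x n"
      using xn by simp
    then have t1: "1 < ?t"
      using Xn(3) by linarith
    have inv: "((\<lambda>t. 1 / t) has_integral ln ?t) ?I"
      using has_integral_reciprocal_mult[of "x n" ?t] xn t1 by (simp add: x_Suc)
    have udi: "(\<lambda>t. u t / t) integrable_on ?I"
      using xn by (intro bounded_measurable_divide_integrable[OF uC]) auto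
    have "integral ?I (\<lambda>t. u t / t) / ln ?t \<le> w"
      using Xn(2) unfolding u log_average_abs_linf[OF uC xn(1)] x_Suc .
    then have "integral ?I (\<lambda>t. u t / t) \<le> w * ln ?t"
      using t1 by (simp add: divide_le_eq)
    then have neg: "x n * (integral ?I (\<lambda>t. u t / t) - w * ln ?t) \<le> 0"
      using xn by (intro mult_nonneg_nonpos) auto
    \<comment> \<open>The split is u = (x_n/t)(u - w) + ((t - x_n)/t)(u - w) + w. The first term has
      nonpositive integral because the logarithmic average is at most \<open>w\<close>; the second
      is at most \<open>e\<close>, since (t - x_n)/t is at most \<tau>(x_n) - 1.\<close>
    have pointwise: "u t \<le> x n * (u t / t - w * (1 / t)) + (w + e)" if t: "t \<in> ?I" for t
    proof -
      have tpos: "0 < t" using t xn by auto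
      have "t - x n \<le> (?t - 1) * x n"
        using t by (simp add: x_Suc algebra_simps)
      also have "\<dots> \<le> (?t - 1) * t"
        using t t1 by (intro mult_left_mono) auto
      finally have "(t - x n) / t \<le> ?t - 1"
        using tpos by (simp add: divide_le_eq)
      then have "(t - x n) / t * \<bar>u t - w\<bar> \<le> (?t - 1) * (C + \<bar>w\<bar>)"
        using uw t tpos t1 by (intro mult_mono) auto
      moreover have "(t - x n) / t * (u t - w) \<le> (t - x n) / t * \<bar>u t - w\<bar>"
        using t tpos by (intro mult_left_mono) auto
      moreover have "u t = x n * (u t / t - w * (1 / t)) + (t - x n) / t * (u t - w) + w"
        using tpos by (simp add: field_simps)
      ultimately show ?thesis
        using Xn(1) by (simp add: mult.commute)
    qed
    have R: "((\<lambda>t. x n * (u t / t - w * (1 / t)) + (w + e)) has_integral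
        x n * (integral ?I (\<lambda>t. u t / t) - w * ln ?t) + (x (Suc n) - x n) * (w + e)) ?I"
      using has_integral_const_real[of "w + e" "x n" "x (Suc n)"] xn
      by (intro has_integral_add has_integral_mult_right has_integral_diff inv
          integrable_integral udi) auto
    have "integral ?I u \<le> x n * (integral ?I (\<lambda>t. u t / t) - w * ln ?t) + (x (Suc n) - x n) * (w + e)"
      using integrable_integral[OF ui] R pointwise by (rule has_integral_le)
    then show ?thesis
      using neg xn by (simp add: b_def divide_le_eq mult.commute)
  qed
  \<comment> \<open>Before the first block the value \<open>w\<close> keeps \<open>g\<close> below
    \<open>w + e\<close>; this bounded stretch does not affect the mean.\<close>
  define g where "g t = (if t < x 0 then w else b (LEAST n. t < x (Suc n)))" for t
  have g_block: "g t = b n" if "x n \<le> t" "t < x (Suc n)" for n t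
  proof -
    note mono = monoD[OF mono_of_unit_steps(1)[of x, OF step]]
    have "(LEAST n. t < x (Suc n)) = n"
    proof (rule Least_equality)
      fix m assume "t < x (Suc m)"
      then have "\<not> Suc m \<le> n"
        using mono[of "Suc m" n] that by linarith
      then show "n \<le> m" by simp
    qed fact
    moreover have "x 0 \<le> t"
      using mono[of 0 n] that by simp
    ultimately show ?thesis by (simp add: g_def)
  qed
  have g_le: "g t \<le> w + e" for t
    using b_le e by (simp add: g_def)
  have "(\<lambda>t. LEAST n. t < x (Suc n)) \<in> borel \<rightarrow>\<^sub>M count_space UNIV"
    by (rule measurable_Least) simp
  from measurable_compose[OF this, of b borel]
  have "(\<lambda>t. b (LEAST n. t < x (Suc n))) \<in> borel_measurable borel"
    by simp
  then have "g \<in> borel_measurable borel"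
    unfolding g_def[abs_def] by (intro measurable_If) auto
  then have "g \<in> borel_measurable lebesgue"
    by (intro measurable_completion) simp
  moreover have "\<bar>g t\<bar> \<le> C + \<bar>w\<bar>" for t
    using b_abs[of "LEAST n. t < x (Suc n)"] bounded_measurableD(3)[OF uC]
    unfolding g_def by (split if_split) (intro conjI impI; linarith)
  ultimately have g: "bounded_measurable g (C + \<bar>w\<bar>)"
    unfolding bounded_measurable_def by blast
  have h: "bounded_measurable (\<lambda>t. u t - g t) (C + (C + \<bar>w\<bar>))"
    by (rule bounded_measurable_diff[OF uC g])
  have "has_mean (abs_linf (\<lambda>t. u t - g t)) 0"
  proof (rule mean_zero_of_blocks[OF h _ step ratio])
    show "1 \<le> x 0" using x_ge by simp
    fix n
    \<comment> \<open>The right endpoint already carries the next block's value, hence the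
      exceptional point.\<close>
    have "integral {x n..x (Suc n)} g = integral {x n..x (Suc n)} (\<lambda>_. b n)"
      by (rule integral_spike[where S = "{x (Suc n)}"]) (auto simp: g_block)
    also have "\<dots> = integral {x n..x (Suc n)} u"
      using step[of n] by (simp add: b_def)
    finally show "integral {x n..x (Suc n)} (\<lambda>t. u t - g t) = 0"
      using Henstock_Kurzweil_Integration.integral_diff[OF ui bounded_measurable_integrable[OF g]]
      by simp
  qed
  then have "blinfun_apply \<psi> (abs_linf (\<lambda>t. u t - g t)) = 0"
    using \<psi> by (auto simp: mean_functionals_def E0_def)
  then have "blinfun_apply \<psi> f = blinfun_apply \<psi> (abs_linf g)"
    unfolding linf_ops_bounded_measurable(2)[OF uC g, symmetric] u[symmetric]
    by (simp add: blinfun.diff_right)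
  moreover have "blinfun_apply \<psi> (abs_linf g) \<le> w + e"
  proof -
    have c: "bounded_measurable (\<lambda>t. (w + e) * 1) (\<bar>w + e\<bar> * \<bar>1\<bar>)"
      by (intro bounded_measurable_scale bounded_measurable_const)
    have "nonneg_linf ((w + e) *\<^sub>R ?one - abs_linf g)"
      unfolding linf_ops_bounded_measurable(3)[OF bounded_measurable_const bounded_measurable_const]
        linf_ops_bounded_measurable(2)[OF c g]
      using g_le by (intro nonneg_abs_linf[OF bounded_measurable_diff[OF c g]]) auto
    then have "0 \<le> blinfun_apply \<psi> ((w + e) *\<^sub>R ?one - abs_linf g)"
      using \<psi> by (auto simp: mean_functionals_def)
    then show ?thesis
      by (simp add: blinfun.diff_right blinfun.scaleR_right mean_functional_one[OF \<psi>])
  qed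
  ultimately show "blinfun_apply \<psi> f \<le> w + e"
    by simp
qed

section \<open>Existence and value of the limit from the two bounds\<close>

theorem corollary4p4:
  fixes f :: linf
  shows "(SUP \<psi>\<in>mean_functionals. ereal (blinfun_apply \<psi> f)) = Qbar f"
proof -
  define S where "S = (SUP \<psi>\<in>mean_functionals. ereal (blinfun_apply \<psi> f))"
  define Q where "Q \<theta> = Limsup at_top (\<lambda>x. ereal (log_average \<theta> x f))" for \<theta>
  have Q_le: "Q \<theta> \<le> S" if "1 < \<theta>" for \<theta>
  proof (rule ccontr)
    assume "\<not> Q \<theta> \<le> S"
    then obtain a where a: "S < ereal a" "ereal a < Q \<theta>"
      using ereal_dense2 by (metis linorder_not_le)
    have "\<exists>\<^sub>F x in at_top. a < log_average \<theta> x f"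
    proof (rule ccontr)
      assume "\<not> ?thesis"
      then have "\<forall>\<^sub>F x in at_top. ereal (log_average \<theta> x f) \<le> ereal a"
        by (simp add: not_frequently linorder_not_less)
      then have "Q \<theta> \<le> ereal a"
        unfolding Q_def by (rule Limsup_bounded)
      with a(2) show False by simp
    qed
    from mean_functional_ge_frequent_log_average[OF that this]
    obtain \<psi> where "\<psi> \<in> mean_functionals" "a \<le> blinfun_apply \<psi> f"
      by blast
    then have "ereal a \<le> S"
      unfolding S_def by (intro SUP_upper2[of \<psi>]) auto
    with a(1) show False by simp
  qed
  \<comment> \<open>\<open>Lim\<close> is a definite description, so convergence has to be shown
    before its value is known.\<close>
  have "(Q \<longlongrightarrow> S) (at_right 1)"
  proof (rule order_tendstoI)
    fix a assume "a < S"
    show "\<forall>\<^sub>F \<theta> in at_right 1. a < Q \<theta>"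
    proof (rule ccontr)
      assume "\<not> ?thesis"
      then have freq: "\<exists>\<^sub>F \<theta> in at_right 1. Q \<theta> \<le> a"
        by (simp add: not_eventually linorder_not_less)
      \<comment> \<open>A real strictly above \<open>a\<close> turns the bound on the limit superior
        into an eventual bound on the averages; being below \<open>S\<close> it then gives the
        contradiction.\<close>
      obtain w where w: "a < ereal w" "ereal w < S"
        using ereal_dense2[OF \<open>a < S\<close>] by blast
      have "\<forall>\<^sub>F x in at_top. log_average \<theta> x f \<le> w" if "Q \<theta> \<le> a" for \<theta>
      proof -
        have "Q \<theta> < ereal w"
          using that w(1) by simp
        from Limsup_lessD[OF this[unfolded Q_def]] show ?thesis
          by eventually_elim simp
      qed
      with freq have "\<exists>\<^sub>F \<theta> in at_right 1. \<forall>\<^sub>F x in at_top. log_average \<theta> x f \<le> w"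
        by (rule frequently_elim1)
      then have "S \<le> ereal w"
        unfolding S_def by (intro SUP_least) (simp add: mean_functional_le_frequent_log_average)
      with w(2) show False by simp
    qed
  next
    fix a assume "S < a"
    then show "\<forall>\<^sub>F \<theta> in at_right 1. Q \<theta> < a"
      by (intro eventually_mono[OF eventually_at_right_less[of 1]]) (rule le_less_trans[OF Q_le])
  qed
  then have "Lim (at_right 1) Q = S"
    by (intro tendsto_Lim) auto
  then show ?thesis
    by (simp add: Qbar_eq_log_average S_def Q_def[abs_def])
qed

end
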